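(* Let $G$ be one of $\mathrm{GL}_{2n},\mathrm{SL}_{2n},\mathrm{GO}_{2n},\mathrm{O}_{2n},\mathrm{GSp}_{2n},\mathrm{Sp}_{2n}$ over $\mathbb F_q$. Fix $T\in\mathrm{GL}_n(\mathbb F_q)$ such that $\begin{bmatrix}1_n&T\\0&1_n\end{bmatrix}\in G$ and a nontrivial character $\psi\colon\mathbb F_q\to\mathbb C^\times$. Further, fix a character $\chi\colon P\to\mathbb C^\times$, written as $\chi=(\alpha\circ m)(\beta\circ\chi_{\det})$ with characters $\alpha,\beta\colon\mathbb F_q^\times\to\mathbb C^\times$. Then $$If_{\chi,T}=g^G(\beta,\psi,T)\,f_{\chi^J,T}.$$
   Context: $q$ is an odd prime power with $3\nmid q$, and $n\ge1$. Set $\varepsilon=+1$ if $G\in\{\mathrm{GO}_{2n},\mathrm{O}_{2n}\}$ and $\varepsilon=-1$ otherwise, and $J=\begin{bmatrix}0&\varepsilon1_n\\1_n&0\end{bmatrix}$. The groups $\mathrm{GO}_{2n}$ (with $\varepsilon=1$) and $\mathrm{GSp}_{2n}$ (with $\varepsilon=-1$) consist of $g\in\mathrm{GL}_{2n}(\mathbb F_q)$ with $g^\intercal Jg=\lambda J$ for some $\lambda\in\mathbb F_q^\times$; $\mathrm{O}_{2n}$ and $\mathrm{Sp}_{2n}$ are the subgroups with $\lambda=1$. $P=\left\{\begin{bmatrix}A&B\\0&D\end{bmatrix}\in G\right\}$ (with $n\times n$ blocks), and $U=\left\{\begin{bmatrix}1_n&B\\0&1_n\end{bmatrix}\in G\right\}$.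 $\chi_{\det}\colon P\to\mathbb F_q^\times$ is $\begin{bmatrix}A&B\\0&D\end{bmatrix}\mapsto(\det D)^{-1}$. The multiplier $m\colon P\to\mathbb F_q^\times$ is: $m\left(\begin{bmatrix}A&B\\0&D\end{bmatrix}\right)=\det(AD)$ if $G=\mathrm{GL}_{2n}$; $m\left(\begin{bmatrix}\lambda A&B\\0&A^{-\intercal}\end{bmatrix}\right)=\lambda$ if $G\in\{\mathrm{GO}_{2n},\mathrm{GSp}_{2n}\}$; trivial otherwise. (Every character of $P$ has the form $(\alpha\circ m)(\beta\circ\chi_{\det})$.) The character $\chi^J\colon P\to\mathbb C^\times$ is $\chi^J\left(\begin{bmatrix}A&B\\0&D\end{bmatrix}\right)=\chi\left(\begin{bmatrix}D&0\\0&A\end{bmatrix}\right)$. $\operatorname{Ind}_P^G\chi$ is the space of functions $f\colon G\to\mathbb C$ with $f(pg)=\chi(p)f(g)$ for $p\in P$, $g\in G$. The operator $I\colon\operatorname{Ind}_P^G\chi\to\operatorname{Ind}_P^G\chi^J$ is $(If)(g)=\sum_{u\in U}f(J^{-1}ug)$. For a matrix $T$, $\psi_T\colon U\to\mathbb C^\times$ is $\psi_T\left(\begin{bmatrix}1_n&B\\0&1_n\end{bmatrix}\right)=\psi(\operatorname{tr}BT)$. The function $f_{\chi,T}\in\operatorname{Ind}_P^G\chi$ is supported on $PJP=PJU$ and defined by $f_{\chi,T}(pJu)=\chi(p)\psi_T(u)$ for $p\in P$, $u\in U$ (each element of $PJP$ is uniquely of the form $pJu$); $f_{\chi^J,T}$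 is defined the same way with $\chi^J$. The matrix Gauss sum is $$g^G(\beta,\psi,T)=\sum_{\substack{B\in\mathrm{GL}_n(\mathbb F_q)\\ \begin{bmatrix}1_n&B\\0&1_n\end{bmatrix}\in G}}\beta(\det B)\psi(\operatorname{tr}BT).$$ *)

theory Defs
  imports "HOL-Analysis.Analysis"
begin

text \<open>
  The dimension \<open>n \<ge> 1\<close> is \<open>CARD('n)\<close>, and \<open>2n \<times> 2n\<close> matrices are indexed by the sum type
  \<open>'n + 'n\<close>, so that \<open>Inl\<close> and \<open>Inr\<close> address the two blocks. The matrix product and unit are
  \<open>**\<close> and \<open>mat 1\<close>; the operations \<open>*\<close>, \<open>1\<close> and \<open>inverse\<close> of the type class
  hierarchy are componentwise on \<open>vec\<close> and are never applied to matrices here.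
\<close>

type_synonym ('a, 'n) mat2 = "(('a, 'n + 'n) vec, 'n + 'n) vec"

definition block ::
  "'a^'n^'n \<Rightarrow> 'a^'n^'n \<Rightarrow> 'a^'n^'n \<Rightarrow> 'a^'n^'n \<Rightarrow> ('a, 'n::finite) mat2" where
  "block A B C D = (\<chi> i j. case i of
      Inl k \<Rightarrow> (case j of Inl l \<Rightarrow> A $ k $ l | Inr l \<Rightarrow> B $ k $ l)
    | Inr k \<Rightarrow> (case j of Inl l \<Rightarrow> C $ k $ l | Inr l \<Rightarrow> D $ k $ l))"

definition upper_left :: "('a, 'n::finite) mat2 \<Rightarrow> 'a^'n^'n" where
  "upper_left M = (\<chi> i j. M $ Inl i $ Inl j)"

definition upper_right :: "('a, 'n::finite) mat2 \<Rightarrow> 'a^'n^'n" where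
  "upper_right M = (\<chi> i j. M $ Inl i $ Inr j)"

definition lower_right :: "('a, 'n::finite) mat2 \<Rightarrow> 'a^'n^'n" where
  "lower_right M = (\<chi> i j. M $ Inr i $ Inr j)"

definition mat_smult :: "'a::times \<Rightarrow> 'a^'n^'m \<Rightarrow> 'a^'n^'m" where
  "mat_smult c M = map_matrix ((*) c) M"

datatype group_kind = GL | SL | GO | Orth | GSp | Sp

definition eps :: "group_kind \<Rightarrow> 'a::field" where
  "eps K = (if K \<in> {GO, Orth} then 1 else - 1)"

definition Jmat :: "group_kind \<Rightarrow> ('a::field, 'n::finite) mat2" where
  "Jmat K = block 0 (mat (eps K)) (mat 1) 0"

fun grp :: "group_kind \<Rightarrow> ('a::field, 'n::finite) mat2 set" where
  "grp GL = {g. invertible g}"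
| "grp SL = {g. invertible g \<and> det g = 1}"
| "grp GO = {g. invertible g \<and>
     (\<exists>l. l \<noteq> 0 \<and> transpose g ** Jmat GO ** g = mat_smult l (Jmat GO))}"
| "grp Orth = {g. invertible g \<and> transpose g ** Jmat Orth ** g = Jmat Orth}"
| "grp GSp = {g. invertible g \<and>
     (\<exists>l. l \<noteq> 0 \<and> transpose g ** Jmat GSp ** g = mat_smult l (Jmat GSp))}"
| "grp Sp = {g. invertible g \<and> transpose g ** Jmat Sp ** g = Jmat Sp}"

definition parabolic :: "group_kind \<Rightarrow> ('a::field, 'n::finite) mat2 set" where
  "parabolic K = {p \<in> grp K. \<exists>A B D. p = block A B 0 D}"

definition unip :: "'a::field^'n^'n \<Rightarrow> ('a, 'n::finite) mat2" where
  "unip B = block (mat 1) B 0 (mat 1)"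

definition unipotent :: "group_kind \<Rightarrow> ('a::field, 'n::finite) mat2 set" where
  "unipotent K = {u \<in> grp K. \<exists>B. u = unip B}"

definition character_on :: "('g \<Rightarrow> 'g \<Rightarrow> 'g) \<Rightarrow> 'g set \<Rightarrow> ('g \<Rightarrow> complex) \<Rightarrow> bool" where
  "character_on opn H chi \<longleftrightarrow>
     (\<forall>x\<in>H. chi x \<noteq> 0) \<and> (\<forall>x\<in>H. \<forall>y\<in>H. chi (opn x y) = chi x * chi y)"

definition chi_det :: "('a::field, 'n::finite) mat2 \<Rightarrow> 'a" where
  "chi_det p = inverse (det (lower_right p))"

definition similitude_multiplier :: "('a::field, 'n::finite) mat2 \<Rightarrow> 'a" where
  "similitude_multiplier p = (THE l. l \<noteq> 0 \<and>
     (\<exists>A B. invertible A \<and> p = block (mat_smult l A) B 0 (transpose (matrix_inv A))))"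

fun multiplier :: "group_kind \<Rightarrow> ('a::field, 'n::finite) mat2 \<Rightarrow> 'a" where
  "multiplier GL p = det (upper_left p ** lower_right p)"
| "multiplier GO p = similitude_multiplier p"
| "multiplier GSp p = similitude_multiplier p"
| "multiplier _ p = 1"

definition conj_char ::
  "(('a::field, 'n::finite) mat2 \<Rightarrow> complex) \<Rightarrow> ('a, 'n) mat2 \<Rightarrow> complex" where
  "conj_char chi p = chi (block (lower_right p) 0 0 (upper_left p))"

text \<open>
  Functions on the group are total functions on matrices of which only the values on
  \<open>grp K\<close> are meaningful.
\<close>

definition induced ::
  "group_kind \<Rightarrow> (('a::field, 'n::finite) mat2 \<Rightarrow> complex) \<Rightarrow> (('a, 'n) mat2 \<Rightarrow> complex) set" where
  "induced K chi = {f. \<forall>p\<in>parabolic K. \<forall>g\<in>grp K. f (p ** g) = chi p * f g}"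

definition intertwine ::
  "group_kind \<Rightarrow> (('a::field, 'n::finite) mat2 \<Rightarrow> complex) \<Rightarrow> ('a, 'n) mat2 \<Rightarrow> complex" where
  "intertwine K f g = (\<Sum>u\<in>unipotent K. f (matrix_inv (Jmat K) ** u ** g))"

definition psi_T :: "('a::field \<Rightarrow> complex) \<Rightarrow> 'a^'n^'n \<Rightarrow> ('a, 'n::finite) mat2 \<Rightarrow> complex" where
  "psi_T \<psi> T u = \<psi> (trace (upper_right u ** T))"

text \<open>The pair below is unique when it exists, see \<open>big_cell_unique\<close>.\<close>

definition big_cell_fun ::
  "group_kind \<Rightarrow> ('a::field \<Rightarrow> complex) \<Rightarrow> (('a, 'n::finite) mat2 \<Rightarrow> complex) \<Rightarrow> 'a^'n^'n
     \<Rightarrow> ('a, 'n) mat2 \<Rightarrow> complex" where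
  "big_cell_fun K \<psi> chi T g =
    (if \<exists>p\<in>parabolic K. \<exists>u\<in>unipotent K. g = p ** Jmat K ** u
     then let (p, u) = (THE (p, u). p \<in> parabolic K \<and> u \<in> unipotent K \<and> g = p ** Jmat K ** u)
          in chi p * psi_T \<psi> T u
     else 0)"

definition gauss_sum ::
  "group_kind \<Rightarrow> ('a::field \<Rightarrow> complex) \<Rightarrow> ('a \<Rightarrow> complex) \<Rightarrow> 'a^'n^'n \<Rightarrow> complex" where
  "gauss_sum K \<beta> \<psi> T =
    (\<Sum>B | invertible B \<and> unip B \<in> grp K. \<beta> (det B) * \<psi> (trace (B ** T)))"


text \<open>The following facts show that \<open>big_cell_fun\<close> is well defined and lies in the induced space.\<close>

lemma block_nth [simp]:
  "block A B C D $ Inl i $ Inl j = A $ i $ j"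
  "block A B C D $ Inl i $ Inr j = B $ i $ j"
  "block A B C D $ Inr i $ Inl j = C $ i $ j"
  "block A B C D $ Inr i $ Inr j = D $ i $ j"
  by (simp_all add: block_def)

lemma block_sel [simp]:
  "upper_left (block A B C D) = A"
  "upper_right (block A B C D) = B"
  "lower_right (block A B C D) = D"
  by (simp_all add: upper_left_def upper_right_def lower_right_def vec_eq_iff)

lemma sum_plus_UNIV:
  fixes f :: "'n::finite + 'n \<Rightarrow> 'b::comm_monoid_add"
  shows "sum f UNIV = (\<Sum>i\<in>UNIV. f (Inl i)) + (\<Sum>i\<in>UNIV. f (Inr i))"
  by (subst UNIV_Plus_UNIV [symmetric], subst sum.Plus) auto

lemma mat2_eq_iff:
  fixes M N :: "('a, 'n::finite) mat2"
  shows "M = N \<longleftrightarrow> (\<forall>i j. M $ Inl i $ Inl j = N $ Inl i $ Inl j \<and> M $ Inl i $ Inr j = N $ Inl i $ Inr j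
    \<and> M $ Inr i $ Inl j = N $ Inr i $ Inl j \<and> M $ Inr i $ Inr j = N $ Inr i $ Inr j)"
  by (simp add: vec_eq_iff split_sum_all) blast

lemma block_eq_iff [simp]:
  "block A B C D = block A' B' C' D' \<longleftrightarrow> A = A' \<and> B = B' \<and> C = C' \<and> D = D'"
  by (auto simp: mat2_eq_iff vec_eq_iff)

lemma block_cases:
  fixes M :: "('a, 'n::finite) mat2"
  obtains A B C D where "M = block A B C D"
proof
  show "M = block (upper_left M) (upper_right M) (\<chi> i j. M $ Inr i $ Inl j) (lower_right M)"
    by (simp add: mat2_eq_iff upper_left_def upper_right_def lower_right_def)
qed

lemma block_mult:
  "block A B C D ** block A' B' C' D' =
     block (A ** A' + B ** C') (A ** B' + B ** D') (C ** A' + D ** C') (C ** B' + D ** D')"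
  by (simp add: mat2_eq_iff matrix_matrix_mult_def sum_plus_UNIV)

lemma mat_block: "(mat c :: ('a::zero, 'n::finite) mat2) = block (mat c) 0 0 (mat c)"
  by (simp add: mat2_eq_iff mat_def)

lemma matrix_mult_zero [simp]:
  "(0 :: 'a::semiring_1^'n^'m) ** (A :: 'a^'k^'n) = 0" "(B :: 'a^'n^'m) ** (0 :: 'a^'k^'n) = 0"
  by (simp_all add: matrix_matrix_mult_def vec_eq_iff)

lemma mat_smult_mult:
  "A ** mat_smult (c::'a::comm_semiring_1) B = mat_smult c (A ** B)"
  "mat_smult c A ** B = mat_smult c (A ** B)"
  by (simp_all add: mat_smult_def matrix_matrix_mult_def vec_eq_iff sum_distrib_left mult_ac)

lemma mat_smult_smult: "mat_smult c (mat_smult d A) = mat_smult (c * d :: 'a::semigroup_mult) A"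
  by (simp add: mat_smult_def vec_eq_iff mult.assoc)

lemma mat_smult_one [simp]: "mat_smult (1::'a::monoid_mult) A = A"
  by (simp add: mat_smult_def vec_eq_iff)

lemma eps_square [simp]: "eps K * eps K = (1::'a::field)"
  by (simp add: eps_def)

lemma mat_mult_mat: "mat a ** mat b = (mat (a * b) :: 'a::semiring_1^'n^'n)"
proof -
  have "(if i = k then a else 0) * (if k = j then b else 0) =
      (if k = i then if i = j then a * b else 0 else 0)" for i j k :: 'n
    by auto
  thus ?thesis
    by (simp add: matrix_matrix_mult_def mat_def vec_eq_iff)
qed

lemma matrix_inv_Jmat:
  "Jmat K ** block 0 (mat 1) (mat (eps K)) 0 = mat 1"
  "block 0 (mat 1) (mat (eps K)) 0 ** Jmat K = mat 1"
  by (simp_all add: Jmat_def block_mult mat_mult_mat mat_block)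

lemma invertible_Jmat: "invertible (Jmat K)"
  using matrix_inv_Jmat by (auto simp: invertible_def)

lemma grp_invertible: "g \<in> grp K \<Longrightarrow> invertible g"
  by (cases K) auto

lemma similitude_mult:
  fixes J :: "'a::field^'m^'m"
  assumes "transpose g ** J ** g = mat_smult l J" "transpose h ** J ** h = mat_smult k J"
  shows "transpose (g ** h) ** J ** (g ** h) = mat_smult (l * k) J"
proof -
  have "transpose (g ** h) ** J ** (g ** h) = transpose h ** (transpose g ** J ** g) ** h"
    by (simp add: matrix_transpose_mul matrix_mul_assoc)
  also have "\<dots> = mat_smult (l * k) J"
    by (simp add: assms mat_smult_mult mat_smult_smult)
  finally show ?thesis .
qed

lemma similitude_inverse:
  fixes J :: "'a::field^'m^'m"
  assumes "transpose g ** J ** g = mat_smult l J" "l \<noteq> 0" "g ** h = mat 1"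
  shows "transpose h ** J ** h = mat_smult (inverse l) J"
proof -
  have "J = transpose (g ** h) ** J ** (g ** h)"
    by (simp add: assms(3))
  also have "\<dots> = transpose h ** (transpose g ** J ** g) ** h"
    by (simp add: matrix_transpose_mul matrix_mul_assoc)
  also have "\<dots> = mat_smult l (transpose h ** J ** h)"
    by (simp add: assms(1) mat_smult_mult)
  finally have "mat_smult (inverse l) J
      = mat_smult (inverse l) (mat_smult l (transpose h ** J ** h))"
    by (rule arg_cong)
  thus ?thesis
    using assms(2) by (simp add: mat_smult_smult)
qed

lemma grp_mult:
  assumes "g \<in> grp K" "h \<in> grp K"
  shows "g ** h \<in> grp K"
proof -
  have inv: "invertible (g ** h)"
    using assms grp_invertible invertible_mult by blast
  show ?thesis
  proof (cases K)
    case GO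
    with assms inv show ?thesis
      by simp (metis mult_eq_0_iff similitude_mult)
  next
    case GSp
    with assms inv show ?thesis
      by simp (metis mult_eq_0_iff similitude_mult)
  next
    case Orth
    with assms inv show ?thesis
      using similitude_mult[of g "Jmat K" 1 h 1] by simp
  next
    case Sp
    with assms inv show ?thesis
      using similitude_mult[of g "Jmat K" 1 h 1] by simp
  qed (use assms inv in \<open>auto simp: det_mul\<close>)
qed

lemma grp_inverse:
  assumes "g \<in> grp K" "g ** h = mat 1"
  shows "h \<in> grp K"
proof -
  have inv: "invertible h"
    using assms(2) by (metis invertible_def matrix_left_right_inverse)
  show ?thesis
  proof (cases K)
    case SL
    have "det g * det h = 1"
      using assms(2) by (metis det_I det_mul)
    with assms SL inv show ?thesis by simp
  next
    case GO
    with assms inv show ?thesis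
      by simp (metis inverse_nonzero_iff_nonzero similitude_inverse)
  next
    case GSp
    with assms inv show ?thesis
      by simp (metis inverse_nonzero_iff_nonzero similitude_inverse)
  next
    case Orth
    with assms inv show ?thesis
      using similitude_inverse[of g "Jmat K" 1 h] by simp
  next
    case Sp
    with assms inv show ?thesis
      using similitude_inverse[of g "Jmat K" 1 h] by simp
  qed (use inv in auto)
qed

lemma parabolic_mult:
  assumes "p \<in> parabolic K" "q \<in> parabolic K"
  shows "p ** q \<in> parabolic K"
  using assms by (auto simp: parabolic_def grp_mult block_mult)

lemma parabolic_inverse:
  fixes p :: "('a::field, 'n::finite) mat2"
  assumes "p \<in> parabolic K"
  obtains q where "q \<in> parabolic K" "p ** q = mat 1" "q ** p = mat 1"
proof -
  from assms obtain A B D where p: "p = block A B 0 D" "p \<in> grp K"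
    by (auto simp: parabolic_def)
  from p obtain q where q: "p ** q = mat 1" "q ** p = mat 1"
    using grp_invertible by (auto simp: invertible_def)
  obtain a b c d where q_eq: "q = block a b c d"
    by (rule block_cases)
  have D: "D ** d = mat 1" "D ** c = 0"
    using q(1) by (simp_all add: p q_eq block_mult mat_block)
  hence "d ** D = mat 1"
    by (metis matrix_left_right_inverse)
  hence "c = 0"
    using D(2) by (metis matrix_mul_assoc matrix_mul_lid matrix_mult_zero(2))
  hence "q \<in> parabolic K"
    using grp_inverse[OF p(2) q(1)] by (auto simp: parabolic_def q_eq)
  with q show thesis
    using that by blast
qed

lemma big_cell_unique:
  fixes p p' :: "('a::field, 'n::finite) mat2"
  assumes "p \<in> parabolic K" "p' \<in> parabolic K" "u \<in> unipotent K" "u' \<in> unipotent K"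
    and eq: "p ** Jmat K ** u = p' ** Jmat K ** u'"
  shows "p = p' \<and> u = u'"
proof -
  obtain A B D where p: "p = block A B 0 D"
    using assms by (auto simp: parabolic_def)
  obtain A' B' D' where p': "p' = block A' B' 0 D'"
    using assms by (auto simp: parabolic_def)
  obtain X where u: "u = unip X"
    using assms by (auto simp: unipotent_def)
  obtain X' where u': "u' = unip X'"
    using assms by (auto simp: unipotent_def)
  obtain q where q: "q \<in> parabolic K" "q ** p = mat 1"
    using assms(1) by (rule parabolic_inverse)
  obtain E F H where q_eq: "q = block E F 0 H"
    using q(1) by (auto simp: parabolic_def)
  have HD: "H ** D = mat 1"
    using q(2) by (simp add: p q_eq block_mult mat_block)
  have "D = D' \<and> D ** X = D' ** X'"
    using eq by (auto simp: p p' u u' unip_def Jmat_def block_mult)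
  hence "D ** X = D ** X'"
    by metis
  hence "H ** D ** X = H ** D ** X'"
    by (simp add: matrix_mul_assoc[symmetric])
  hence uu: "u = u'"
    by (simp add: u u' HD)
  have "invertible (Jmat K ** u')"
    using assms(4) invertible_mult[OF invertible_Jmat] grp_invertible
    by (auto simp: unipotent_def)
  then obtain w where "(Jmat K ** u') ** w = mat 1"
    by (auto simp: invertible_def)
  moreover have "p ** ((Jmat K ** u') ** w) = p' ** ((Jmat K ** u') ** w)"
    using eq by (simp add: uu matrix_mul_assoc)
  ultimately show ?thesis
    using uu by simp
qed

lemma big_cell_fun_apply:
  fixes p :: "('a::field, 'n::finite) mat2"
  assumes "p \<in> parabolic K" "u \<in> unipotent K"
  shows "big_cell_fun K \<psi> chi T (p ** Jmat K ** u) = chi p * psi_T \<psi> T u"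
proof -
  have "(THE (p', u'). p' \<in> parabolic K \<and> u' \<in> unipotent K \<and>
      p ** Jmat K ** u = p' ** Jmat K ** u') = (p, u)"
  proof (rule the_equality, goal_cases)
    case 1
    show ?case using assms by simp
  next
    case (2 z)
    obtain p' u' where "z = (p', u')"
      by (cases z)
    with 2 show ?case
      using big_cell_unique[OF assms(1) _ assms(2), of p' u'] by simp
  qed
  moreover have "\<exists>p'\<in>parabolic K. \<exists>u'\<in>unipotent K. p ** Jmat K ** u = p' ** Jmat K ** u'"
    using assms by blast
  ultimately show ?thesis
    by (simp add: big_cell_fun_def)
qed

lemma big_cell_fun_induced:
  fixes chi :: "('a::field, 'n::finite) mat2 \<Rightarrow> complex"
  assumes "character_on (**) (parabolic K) chi"
  shows "big_cell_fun K \<psi> chi T \<in> induced K chi"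
  unfolding induced_def
proof (intro CollectI ballI)
  fix p g :: "('a, 'n) mat2"
  assume p: "p \<in> parabolic K" and "g \<in> grp K"
  show "big_cell_fun K \<psi> chi T (p ** g) = chi p * big_cell_fun K \<psi> chi T g"
  proof (cases "\<exists>p'\<in>parabolic K. \<exists>u\<in>unipotent K. g = p' ** Jmat K ** u")
    case True
    then obtain p' u where g: "p' \<in> parabolic K" "u \<in> unipotent K" "g = p' ** Jmat K ** u"
      by blast
    have "p ** g = (p ** p') ** Jmat K ** u"
      by (simp add: g matrix_mul_assoc)
    thus ?thesis
      using assms p g
      by (simp add: big_cell_fun_apply parabolic_mult character_on_def)
  next
    case False
    obtain q where q: "q \<in> parabolic K" "q ** p = mat 1"
      using p by (rule parabolic_inverse)
    have "\<not> (\<exists>p'\<in>parabolic K. \<exists>u\<in>unipotent K. p ** g = p' ** Jmat K ** u)"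
    proof safe
      fix p' u assume *: "p' \<in> parabolic K" "u \<in> unipotent K" "p ** g = p' ** Jmat K ** u"
      have "g = (q ** p) ** g"
        by (simp add: q)
      also have "\<dots> = (q ** p') ** Jmat K ** u"
        using *(3) by (simp add: matrix_mul_assoc[symmetric])
      finally show False
        using False q(1) * parabolic_mult by blast
    qed
    with False show ?thesis
      by (simp add: big_cell_fun_def)
  qed
qed

end

theory Submission
  imports Defs
begin

text \<open>
  The operator \<open>I\<close> intertwines left translation by \<open>P\<close> (it maps \<open>Ind \<chi>\<close> to \<open>Ind \<chi>\<^sup>J\<close>, see
  \<open>intertwine_induced\<close>) and commutes with right translation, and \<open>f\<close> transforms under right translation
  by \<open>U\<close> through \<open>\<psi>\<^sub>T\<close>. Hence both sides of the identity transform in the same way under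
  \<open>P \<times> U\<close>, and it suffices to compare them on one representative of each double coset of \<open>P\<close> and
  \<open>U\<close>. The cosets fall into two sorts.

  On the big cell \<open>P J U\<close> the representative is \<open>J\<close>. With \<open>u\<close> the unipotent element with corner
  \<open>B\<close>, the matrix \<open>J\<^sup>-\<^sup>1 u J\<close> is lower unipotent with corner \<open>\<epsilon> B\<close>; it lies in \<open>P J U\<close> iff
  \<open>B\<close> is invertible, and then its factorization (\<open>opposite_unipotent_factorization\<close>) has \<open>\<epsilon> B\<close> as
  the lower right block of the \<open>P\<close>-part and \<open>\<epsilon> B\<^sup>-\<^sup>1\<close> as the corner of the \<open>U\<close>-part. The multiplier of
  the \<open>P\<close>-part is \<open>1\<close>, so after the substitution \<open>B \<mapsto> \<epsilon> B\<^sup>-\<^sup>1\<close> the sum \<open>(If)(J)\<close> is the Gauss sum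
  (\<open>intertwine_big_cell_fun_Jmat\<close>).

  Off the big cell the right-hand side is \<open>0\<close>, and \<open>(If)(g) = 0\<close> has to be shown for \<open>g\<close> with singular
  lower left block \<open>C\<close> (\<open>intertwine_vanishes_off_big_cell\<close>). If \<open>u \<in> U\<close> is such that
  \<open>p = g u g\<^sup>-\<^sup>1\<close> lies in \<open>P\<close>, then evaluating at \<open>p g = g u\<close> gives
  \<open>\<chi>\<^sup>J(p) (If)(g) = \<psi>\<^sub>T(u) (If)(g)\<close>. The diagonal blocks of such a \<open>p\<close> differ from the unit matrix by
  matrices of square zero and so have determinant \<open>1\<close>, and a similitude factor is invariant under
  conjugation; hence \<open>\<chi>\<^sup>J(p) = 1\<close>, and it remains to find \<open>u\<close> with \<open>\<psi>\<^sub>T(u) \<noteq> 1\<close>. For a vector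
  \<open>v \<noteq> 0\<close> in the kernel of \<open>C\<close>, corners of the form \<open>v w\<^sup>t\<close> (linear groups) or
  \<open>v w\<^sup>t - \<epsilon> w v\<^sup>t\<close> (groups of a form) do the job: the trace of their product with \<open>T\<close> is
  \<open>w\<^sup>t T v\<close> or \<open>2 w\<^sup>t T v\<close>, which in odd characteristic takes every value because \<open>T v \<noteq> 0\<close>
  (\<open>exists_witness_matrix\<close>).
\<close>

section \<open>Determinants over a finite field\<close>

lemma of_nat_CARD_eq_0: "of_nat CARD('a) = (0 :: 'a::{field,finite})"
proof -
  have "(\<Sum>x\<in>(UNIV::'a set). x) = (\<Sum>x\<in>(UNIV::'a set). x + 1)"
    by (rule sum.reindex_bij_witness[where i = "\<lambda>x. x + 1" and j = "\<lambda>x. x - 1"]) auto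
  also have "\<dots> = (\<Sum>x\<in>(UNIV::'a set). x) + of_nat CARD('a)"
    by (simp add: sum.distrib)
  finally show ?thesis by simp
qed

lemma power_CARD_minus_1:
  fixes x :: "'a::{field,finite}"
  assumes "x \<noteq> 0"
  shows "x ^ (CARD('a) - 1) = 1"
proof -
  let ?P = "\<Prod>y\<in>- {0::'a}. y"
  have "?P = (\<Prod>y\<in>- {0}. x * y)"
    by (rule prod.reindex_bij_witness[where i = "\<lambda>y. x * y" and j = "\<lambda>y. y / x"]) (use assms in auto)
  also have "\<dots> = x ^ (CARD('a) - 1) * ?P"
    by (simp add: prod.distrib Compl_eq_Diff_UNIV card_Diff_singleton)
  finally show ?thesis by simp
qed

lemma two_neq_0:
  assumes "odd CARD('a::{field,finite})"
  shows "(2::'a) \<noteq> 0"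
proof
  assume two: "(2::'a) = 0"
  obtain k where "CARD('a) = 2 * k + 1"
    using assms by (elim oddE)
  then have "of_nat CARD('a) = (2 * of_nat k + 1 :: 'a)"
    by simp
  with two show False by (simp add: of_nat_CARD_eq_0)
qed

lemma mat_smult_zero [simp]:
  "mat_smult (0::'a::semiring_1) A = 0" "mat_smult c (0 :: 'a::semiring_1^'n^'m) = 0"
  by (simp_all add: mat_smult_def vec_eq_iff)

lemma transpose_zero [simp]: "transpose (0 :: 'a::zero^'n^'m) = 0"
  by (simp add: transpose_def vec_eq_iff)

lemma matrix_add_rdistrib: "(A + B) ** C = A ** C + B ** (C :: 'a::semiring_1^'n^'m)"
  by (simp add: matrix_matrix_mult_def vec_eq_iff distrib_right sum.distrib)

text \<open>
  Since \<open>M\<close> has square zero, \<open>k \<mapsto> 1 + k M\<close> turns sums into products, so the \<open>q\<close>-th power of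
  \<open>det (1 + M)\<close> is \<open>det (1 + q M) = det 1 = 1\<close>; but in a field with \<open>q\<close> elements the
  \<open>q\<close>-th power is the identity map.
\<close>

lemma det_one_plus_square_zero:
  fixes M :: "'a::{field,finite}^'m^'m"
  assumes "M ** M = 0"
  shows "det (mat 1 + M) = 1"
proof -
  let ?d = "det (mat 1 + M)"
  have pow: "det (mat 1 + mat_smult (of_nat k) M) = ?d ^ k" for k
  proof (induction k)
    case 0
    show ?case by simp
  next
    case (Suc k)
    have "mat 1 + mat_smult (of_nat (Suc k)) M = (mat 1 + mat_smult (of_nat k) M) ** (mat 1 + M)"
      by (simp add: matrix_add_ldistrib matrix_add_rdistrib mat_smult_mult assms)
        (simp add: mat_smult_def vec_eq_iff algebra_simps)
    then show ?case
      by (simp only: det_mul Suc.IH power_Suc2)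
  qed
  have q: "?d ^ CARD('a) = 1"
    using pow[of "CARD('a)"]
    by (simp add: of_nat_CARD_eq_0)
  then have "?d \<noteq> 0"
    by (metis zero_less_card_finite power_0_left zero_neq_one less_irrefl)
  then have "?d ^ (CARD('a) - 1) = 1"
    by (rule power_CARD_minus_1)
  moreover have "?d ^ CARD('a) = ?d ^ (CARD('a) - 1) * ?d"
    by (metis power_Suc2 Suc_pred' zero_less_card_finite)
  ultimately show ?thesis using q by simp
qed

section \<open>Block matrices in the classical groups\<close>

lemma transpose_block:
  "transpose (block A B C D) = block (transpose A) (transpose C) (transpose B) (transpose D)"
  by (simp add: mat2_eq_iff transpose_def)

lemma block_add: "block A B C D + block A' B' C' D' = block (A + A') (B + B') (C + C') (D + D')"
  by (simp add: mat2_eq_iff)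

lemma mat_smult_block:
  "mat_smult c (block A B C D) = block (mat_smult c A) (mat_smult c B) (mat_smult c C) (mat_smult c D)"
  by (simp add: mat2_eq_iff mat_smult_def)

lemma mat_eq_mat_smult: "mat c = mat_smult c (mat 1 :: 'a::semiring_1^'n^'n)"
  by (simp add: mat_smult_def mat_def vec_eq_iff)

lemma uminus_eq_mat_smult: "- A = mat_smult (- 1) (A :: 'a::ring_1^'n^'m)"
  by (simp add: mat_smult_def vec_eq_iff)

lemma mat_mult_eq_mat_smult:
  "mat c ** A = mat_smult c (A :: 'a::comm_semiring_1^'n^'m)"
  "B ** mat c = mat_smult c (B :: 'a::comm_semiring_1^'n^'m)"
  by (simp_all add: mat_eq_mat_smult[of c] mat_smult_mult)

lemma mat_eq_mat_iff [simp]: "(mat a :: 'a::zero^'n^'n) = mat b \<longleftrightarrow> a = b"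
  by (auto simp: mat_def vec_eq_iff)

lemma mat_smult_add: "mat_smult c (A + B) = mat_smult c A + mat_smult c (B :: 'a::semiring_1^'n^'m)"
  by (simp add: mat_smult_def vec_eq_iff distrib_left)

lemma transpose_mat_smult: "transpose (mat_smult c A) = mat_smult c (transpose A)"
  by (simp add: mat_smult_def transpose_def vec_eq_iff)

lemma unip_mult: "unip X ** unip Y = unip (X + Y)"
  by (simp add: unip_def block_mult add.commute)

lemma unip_0: "unip 0 = mat 1"
  by (simp add: unip_def mat_block)

lemma unip_eq: "unip X = mat 1 + block 0 X 0 0"
  by (simp add: unip_def mat_block block_add)

lemma det_unip: "det (unip X :: ('a::{field,finite}, 'n::finite) mat2) = 1"
  unfolding unip_eq by (rule det_one_plus_square_zero) (simp add: block_mult mat2_eq_iff)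

lemma invertible_unip: "invertible (unip X)"
  unfolding invertible_def
  by (rule exI[of _ "unip (- X)"]) (simp add: unip_mult unip_0)

text \<open>
  The factorization below, well known from \<open>SL\<^sub>2\<close>, reduces this to square-zero perturbations
  of the unit matrix.
\<close>

lemma det_symplectic_J:
  "det (block 0 (- mat 1) (mat 1) 0 :: ('a::{field,finite}, 'n::finite) mat2) = 1"
proof -
  let ?U = "unip (- mat 1) :: ('a, 'n) mat2" and ?L = "block (mat 1) 0 (mat 1) (mat 1) :: ('a, 'n) mat2"
  have "block 0 (- mat 1) (mat 1) 0 = ?U ** ?L ** ?U"
    by (simp add: unip_def block_mult)
  moreover have "det ?L = 1"
  proof -
    have "?L = mat 1 + block 0 0 (mat 1) 0"
      by (simp add: mat_block block_add)
    then show ?thesis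
      by (simp only:) (rule det_one_plus_square_zero, simp add: block_mult mat2_eq_iff)
  qed
  ultimately show ?thesis
    by (simp add: det_mul det_unip)
qed

text \<open>
  Treating the four groups of a form together avoids a case distinction in most of the proofs below.
\<close>

definition similitude ::
  "group_kind \<Rightarrow> 'a::field \<Rightarrow> ('a, 'n::finite) mat2 \<Rightarrow> bool" where
  "similitude K l g \<longleftrightarrow> transpose g ** Jmat K ** g = mat_smult l (Jmat K)"

lemma grp_similitude_iff:
  assumes "K \<notin> {GL, SL}"
  shows "g \<in> grp K \<longleftrightarrow>
    invertible g \<and> (\<exists>l. l \<noteq> 0 \<and> similitude K l g \<and> (K \<in> {Orth, Sp} \<longrightarrow> l = 1))"
  using assms by (cases K) (auto simp: similitude_def)

lemma Jmat_in_grp: "(Jmat K :: ('a::{field,finite}, 'n::finite) mat2) \<in> grp K"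
proof (cases "K \<in> {GL, SL}")
  case True
  then have "mat (eps K) = (- mat 1 :: 'a^'n^'n)"
    by (auto simp: eps_def mat_def vec_eq_iff)
  then have "det (Jmat K :: ('a, 'n) mat2) = 1"
    by (simp add: Jmat_def det_symplectic_J)
  with True show ?thesis
    by (auto simp: invertible_Jmat)
next
  case False
  have "similitude K 1 (Jmat K :: ('a, 'n) mat2)"
    by (simp add: similitude_def Jmat_def transpose_block block_mult mat_mult_mat)
  then have "\<exists>l\<noteq>0. similitude K l (Jmat K :: ('a, 'n) mat2) \<and> (K \<in> {Orth, Sp} \<longrightarrow> l = 1)"
    by (intro exI[of _ 1]) simp
  with False show ?thesis
    by (simp only: grp_similitude_iff[OF False] invertible_Jmat simp_thms)
qed

lemma similitude_upper_triangular_iff: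
  fixes A B D :: "'a::field^'n::finite^'n"
  shows "similitude K l (block A B 0 D) \<longleftrightarrow>
    transpose A ** D = mat l \<and> transpose D ** A = mat l \<and>
    transpose D ** B + mat_smult (eps K) (transpose B ** D) = 0"
proof -
  have eps: "mat_smult (eps K) X = mat_smult (eps K) Y \<longleftrightarrow> X = Y" for X Y :: "'a^'n^'n"
    by (metis eps_square mat_smult_smult mat_smult_one)
  have "similitude K l (block A B 0 D) \<longleftrightarrow>
    mat_smult (eps K) (transpose A ** D) = mat_smult (eps K) (mat l) \<and> transpose D ** A = mat l \<and>
    transpose D ** B + mat_smult (eps K) (transpose B ** D) = 0"
    by (auto simp: similitude_def Jmat_def transpose_block block_mult mat_smult_block
        mat_mult_eq_mat_smult mat_smult_mult mat_eq_mat_smult[of l] mat_eq_mat_smult[of "eps K"] mat_smult_smult mult.commute)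
  then show ?thesis by (simp add: eps)
qed

lemma unip_in_grp_iff:
  fixes X :: "'a::{field,finite}^'n::finite^'n"
  shows "unip X \<in> grp K \<longleftrightarrow> K \<in> {GL, SL} \<or> X + mat_smult (eps K) (transpose X) = 0"
proof (cases "K \<in> {GL, SL}")
  case True
  then show ?thesis by (auto simp: invertible_unip det_unip)
next
  case False
  have "similitude K l (unip X) \<longleftrightarrow> mat l = (mat 1 :: 'a^'n^'n) \<and> X + mat_smult (eps K) (transpose X) = 0" for l
    unfolding unip_def similitude_upper_triangular_iff by auto
  then show ?thesis
    using False by (auto simp: grp_similitude_iff[OF False] invertible_unip)
qed

abbreviation Jinv :: "group_kind \<Rightarrow> ('a::field, 'n::finite) mat2" where
  "Jinv K \<equiv> block 0 (mat 1) (mat (eps K)) 0"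

lemma matrix_inv_inverse:
  assumes "invertible (A :: 'a::semiring_1^'n^'n)"
  shows "A ** matrix_inv A = mat 1" "matrix_inv A ** A = mat 1"
proof -
  have "A ** matrix_inv A = mat 1 \<and> matrix_inv A ** A = mat 1"
    using assms unfolding invertible_def matrix_inv_def by (rule someI_ex)
  then show "A ** matrix_inv A = mat 1" "matrix_inv A ** A = mat 1" by simp_all
qed

lemma matrix_inv_eqI:
  fixes A :: "'a::field^'n^'n"
  assumes "A ** B = mat 1"
  shows "matrix_inv A = B"
proof -
  have BA: "B ** A = mat 1"
    using assms matrix_left_right_inverse by blast
  have inv: "invertible A"
    using assms BA by (auto simp: invertible_def)
  have "matrix_inv A = (B ** A) ** matrix_inv A"
    by (simp add: BA)
  also have "\<dots> = B ** (A ** matrix_inv A)"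
    by (simp add: matrix_mul_assoc)
  finally show ?thesis
    using inv by (simp add: matrix_inv_inverse)
qed

lemma matrix_inv_Jmat_eq: "matrix_inv (Jmat K) = Jinv K"
  by (rule matrix_inv_eqI) (rule matrix_inv_Jmat)

lemma Jinv_in_grp: "(Jinv K :: ('a::{field,finite}, 'n::finite) mat2) \<in> grp K"
  by (rule grp_inverse[OF Jmat_in_grp]) (rule matrix_inv_Jmat)

text \<open>
  The second factor is \<open>J\<^sup>-\<^sup>1 g\<^sup>t J\<close>, so that the defining relation of a similitude says that
  it is a left inverse of \<open>g\<close> up to the scalar \<open>l\<close>; for square matrices it is then a right inverse too.
\<close>

lemma similitude_mult_adjoint:
  fixes A B C D :: "'a::field^'n::finite^'n"
  assumes "similitude K l (block A B C D)" "l \<noteq> 0"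
  shows "block A B C D ** block (transpose D) (mat_smult (eps K) (transpose B))
           (mat_smult (eps K) (transpose C)) (transpose A) = mat l"
    (is "?g ** ?h = _")
proof -
  have "?h = Jinv K ** transpose ?g ** Jmat K"
    by (simp add: Jmat_def transpose_block block_mult mat_mult_eq_mat_smult mat_smult_smult)
  then have "?h ** ?g = Jinv K ** (transpose ?g ** Jmat K ** ?g)"
    by (simp add: matrix_mul_assoc)
  also have "\<dots> = mat_smult l (mat 1)"
    using assms(1) by (simp only: similitude_def mat_smult_mult matrix_inv_Jmat)
  finally have "mat_smult (inverse l) ?h ** ?g = mat 1"
    using assms(2) by (simp add: mat_smult_mult mat_smult_smult)
  then have "?g ** mat_smult (inverse l) ?h = mat 1"
    by (rule matrix_left_right_inverse[THEN iffD1])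
  then have "mat_smult l (mat_smult (inverse l) (?g ** ?h)) = mat_smult l (mat 1)"
    by (simp add: mat_smult_mult)
  then show ?thesis
    using assms(2) by (simp add: mat_smult_smult mat_eq_mat_smult[of l])
qed

lemma bottom_row_isotropic:
  fixes A B C D :: "'a::field^'n::finite^'n"
  assumes "block A B C D \<in> grp K" "K \<notin> {GL, SL}"
  shows "C ** transpose D + mat_smult (eps K) (D ** transpose C) = 0"
proof -
  obtain l where "l \<noteq> 0" "similitude K l (block A B C D)"
    using assms by (auto simp: grp_similitude_iff)
  from similitude_mult_adjoint[OF this(2,1)] show ?thesis
    by (simp add: block_mult mat_block[of l] mat_smult_mult)
qed

lemma parabolicD:
  fixes p :: "('a::field, 'n::finite) mat2"
  assumes "p \<in> parabolic K"
  obtains A B D A' D' where "p = block A B 0 D" "A ** A' = mat 1" "A' ** A = mat 1"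
    "D ** D' = mat 1" "D' ** D = mat 1"
proof -
  obtain A B D where p: "p = block A B 0 D"
    using assms by (auto simp: parabolic_def)
  obtain q where q: "q \<in> parabolic K" "p ** q = mat 1"
    using assms by (rule parabolic_inverse)
  obtain A' B' D' where "q = block A' B' 0 D'"
    using q(1) by (auto simp: parabolic_def)
  with p q(2) have AD: "A ** A' = mat 1" "D ** D' = mat 1"
    by (simp_all add: block_mult mat_block)
  with p show thesis
    using that matrix_left_right_inverse by blast
qed

text \<open>
  The second membership comes from conjugation by \<open>J\<close>, which swaps the two diagonal blocks. It
  puts the argument at which \<open>\<chi>\<^sup>J\<close> evaluates \<open>\<chi>\<close> into \<open>P\<close>.
\<close>

lemma levi_in_grp:
  fixes A B D :: "'a::{field,finite}^'n::finite^'n"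
  assumes p: "block A B 0 D \<in> parabolic K"
  shows "block A 0 0 D \<in> grp K" "block D 0 0 A \<in> grp K"
proof -
  have pg: "block A B 0 D \<in> grp K"
    using p by (simp add: parabolic_def)
  obtain A' where A': "A ** A' = mat 1" "A' ** A = mat 1"
    using p by (auto elim!: parabolicD)
  have L: "block A 0 0 D = block A B 0 D ** unip (- (A' ** B))"
    by (simp add: unip_def block_mult uminus_eq_mat_smult mat_smult_mult matrix_mul_assoc A')
      (simp add: mat_smult_def vec_eq_iff)
  show levi: "block A 0 0 D \<in> grp K"
  proof (cases "K \<in> {GL, SL}")
    case True
    then have "unip (- (A' ** B)) \<in> grp K"
      by (simp add: unip_in_grp_iff)
    with pg show ?thesis
      by (simp add: L grp_mult)
  next
    case False
    have "invertible (block A 0 0 D)"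
      unfolding L using grp_invertible[OF pg] invertible_unip invertible_mult by blast
    with pg show ?thesis
      unfolding grp_similitude_iff[OF False] similitude_upper_triangular_iff by auto
  qed
  have "block D 0 0 A = Jinv K ** block A 0 0 D ** Jmat K"
    by (simp add: Jmat_def block_mult mat_mult_eq_mat_smult mat_smult_smult)
  then show "block D 0 0 A \<in> grp K"
    by (simp add: grp_mult levi Jmat_in_grp Jinv_in_grp)
qed

section \<open>Equivariance of the intertwining operator\<close>

lemma unipotentE:
  assumes "u \<in> unipotent K"
  obtains X where "u = unip X" "unip X \<in> grp K"
  using assms by (auto simp: unipotent_def)

lemma unipotentI: "unip X \<in> grp K \<Longrightarrow> unip X \<in> unipotent K"
  by (auto simp: unipotent_def)

lemma unip_uminus_in_grp:
  fixes X :: "'a::field^'n::finite^'n"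
  shows "unip X \<in> grp K \<Longrightarrow> unip (- X) \<in> grp K"
  by (erule grp_inverse) (simp add: unip_mult unip_0)

text \<open>
  Write \<open>L\<close> for the block diagonal part of \<open>p\<close>. Then \<open>u p = L (L\<^sup>-\<^sup>1 u p)\<close>, where
  \<open>u \<mapsto> L\<^sup>-\<^sup>1 u p\<close> permutes \<open>U\<close>, and moving \<open>L\<close> to the left past \<open>J\<^sup>-\<^sup>1\<close> swaps its two blocks, which
  yields the factor \<open>\<chi>\<^sup>J(p)\<close>.
\<close>

lemma intertwine_induced:
  fixes f :: "('a::{field,finite}, 'n::finite) mat2 \<Rightarrow> complex"
  assumes f: "f \<in> induced K chi" and p: "p \<in> parabolic K" and g: "g \<in> grp K"
  shows "intertwine K f (p ** g) = conj_char chi p * intertwine K f g"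
proof -
  obtain A B D A' D' where p_eq: "p = block A B 0 D" and inv: "A ** A' = mat 1" "A' ** A = mat 1"
    "D ** D' = mat 1" "D' ** D = mat 1"
    using p by (rule parabolicD)
  obtain q where q: "q \<in> parabolic K" "p ** q = mat 1" "q ** p = mat 1"
    using p by (rule parabolic_inverse)
  obtain a b d where q_eq: "q = block a b 0 d"
    using q(1) by (auto simp: parabolic_def)
  have ad: "A ** a = mat 1" "D ** d = mat 1"
    using q(2) by (simp_all add: p_eq q_eq block_mult mat_block)
  define L L' where "L = block A 0 0 D" and "L' = block A' 0 0 D'"
  have LL': "L ** L' = mat 1" "L' ** L = mat 1"
    by (simp_all add: L_def L'_def block_mult inv mat_block)
  have L: "L \<in> grp K" "block D 0 0 A \<in> grp K"
    using p levi_in_grp unfolding L_def p_eq by blast+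
  have L': "L' \<in> grp K"
    using L(1) LL'(1) by (rule grp_inverse)
  have pg: "p \<in> grp K" "q \<in> grp K"
    using p q(1) by (auto simp: parabolic_def)
  have swap: "Jinv K ** L = block D 0 0 A ** Jinv K"
    by (simp add: L_def block_mult mat_mult_eq_mat_smult)
  have fwd: "L' ** u ** p \<in> unipotent K" if "u \<in> unipotent K" for u
  proof -
    obtain X where X: "u = unip X" "unip X \<in> grp K"
      using \<open>u \<in> unipotent K\<close> by (rule unipotentE)
    have "L' ** u ** p = unip (A' ** (B + X ** D))"
      by (simp add: X L'_def p_eq unip_def block_mult inv matrix_add_ldistrib matrix_mul_assoc)
    moreover have "L' ** u ** p \<in> grp K"
      using X L' pg by (simp add: grp_mult)
    ultimately show ?thesis
      by (simp add: unipotent_def) blast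
  qed
  have bwd: "L ** u ** q \<in> unipotent K" if "u \<in> unipotent K" for u
  proof -
    obtain X where X: "u = unip X" "unip X \<in> grp K"
      using \<open>u \<in> unipotent K\<close> by (rule unipotentE)
    have "L ** u ** q = unip (A ** (b + X ** d))"
      by (simp add: X L_def q_eq unip_def block_mult ad matrix_add_ldistrib matrix_mul_assoc)
    moreover have "L ** u ** q \<in> grp K"
      using X L pg by (simp add: grp_mult)
    ultimately show ?thesis
      by (simp add: unipotent_def) blast
  qed
  have "intertwine K f (p ** g) = (\<Sum>u\<in>unipotent K. f (Jinv K ** u ** (p ** g)))"
    by (simp add: intertwine_def matrix_inv_Jmat_eq)
  also have "\<dots> = (\<Sum>u\<in>unipotent K. chi (block D 0 0 A) * f (Jinv K ** u ** g))"
  proof (rule sum.reindex_bij_witness[where i = "\<lambda>u. L ** u ** q" and j = "\<lambda>u. L' ** u ** p"])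
    fix u :: "('a, 'n) mat2" assume u: "u \<in> unipotent K"
    show "L ** (L' ** u ** p) ** q = u"
    proof -
      have "L ** (L' ** u ** p) ** q = (L ** L') ** u ** (p ** q)"
        by (simp only: matrix_mul_assoc)
      then show ?thesis by (simp add: LL' q)
    qed
    show "L' ** u ** p \<in> unipotent K"
      using u by (rule fwd)
    have "Jinv K ** u ** (p ** g) = Jinv K ** (L ** L') ** u ** p ** g"
      by (simp add: LL' matrix_mul_assoc)
    also have "\<dots> = (Jinv K ** L) ** ((L' ** u ** p) ** g)"
      by (simp only: matrix_mul_assoc)
    also have "\<dots> = block D 0 0 A ** (Jinv K ** (L' ** u ** p) ** g)"
      by (simp only: swap matrix_mul_assoc)
    finally have "Jinv K ** u ** (p ** g) = block D 0 0 A ** (Jinv K ** (L' ** u ** p) ** g)" .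
    moreover have "Jinv K ** (L' ** u ** p) ** g \<in> grp K"
      using fwd[OF u] g by (simp add: unipotent_def grp_mult Jinv_in_grp)
    moreover have "block D 0 0 A \<in> parabolic K"
      using L(2) by (auto simp: parabolic_def)
    ultimately show "chi (block D 0 0 A) * f (Jinv K ** (L' ** u ** p) ** g) = f (Jinv K ** u ** (p ** g))"
      using f by (simp add: induced_def)
  next
    fix u :: "('a, 'n) mat2" assume u: "u \<in> unipotent K"
    show "L' ** (L ** u ** q) ** p = u"
    proof -
      have "L' ** (L ** u ** q) ** p = (L' ** L) ** u ** (q ** p)"
        by (simp only: matrix_mul_assoc)
      then show ?thesis by (simp add: LL' q)
    qed
    show "L ** u ** q \<in> unipotent K"
      using u by (rule bwd)
  qed
  also have "\<dots> = conj_char chi p * intertwine K f g"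
    by (simp add: intertwine_def matrix_inv_Jmat_eq conj_char_def p_eq sum_distrib_left)
  finally show ?thesis .
qed

lemma big_cell_fun_right_translate:
  fixes g :: "('a::field, 'n::finite) mat2"
  assumes \<psi>: "character_on (+) UNIV \<psi>" and u: "u \<in> unipotent K"
  shows "big_cell_fun K \<psi> chi T (g ** u) = psi_T \<psi> T u * big_cell_fun K \<psi> chi T g"
proof -
  obtain X where X: "u = unip X" "unip X \<in> grp K"
    using u by (rule unipotentE)
  have add: "unip (Y + Z) \<in> unipotent K" if "unip Y \<in> grp K" "unip Z \<in> grp K" for Y Z :: "'a^'n^'n"
    using grp_mult[OF that] by (simp add: unip_mult unipotentI)
  show ?thesis
  proof (cases "\<exists>p\<in>parabolic K. \<exists>w\<in>unipotent K. g = p ** Jmat K ** w")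
    case True
    then obtain p w where pw: "p \<in> parabolic K" "w \<in> unipotent K" "g = p ** Jmat K ** w"
      by blast
    obtain Y where Y: "w = unip Y" "unip Y \<in> grp K"
      using pw(2) by (rule unipotentE)
    have "g ** u = p ** Jmat K ** unip (Y + X)"
      by (simp add: pw(3) X Y unip_mult flip: matrix_mul_assoc)
    then show ?thesis
      using pw \<psi> X Y add[OF Y(2) X(2)]
      by (simp add: big_cell_fun_apply psi_T_def unip_def character_on_def
          matrix_add_rdistrib trace_add)
  next
    case False
    have "\<not> (\<exists>p\<in>parabolic K. \<exists>w\<in>unipotent K. g ** u = p ** Jmat K ** w)"
    proof safe
      fix p w assume *: "p \<in> parabolic K" "w \<in> unipotent K" "g ** u = p ** Jmat K ** w"
      obtain Y where Y: "w = unip Y" "unip Y \<in> grp K"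
        using *(2) by (rule unipotentE)
      have "g = (g ** u) ** unip (- X)"
        by (simp add: X unip_mult unip_0 flip: matrix_mul_assoc)
      also have "\<dots> = p ** Jmat K ** unip (Y + - X)"
        unfolding *(3) by (simp add: Y unip_mult flip: matrix_mul_assoc)
      finally show False
        using False *(1) add[OF Y(2) unip_uminus_in_grp[OF X(2)]] by blast
    qed
    with False show ?thesis
      by (simp add: big_cell_fun_def)
  qed
qed

lemma intertwine_big_cell_fun_right_translate:
  fixes g :: "('a::{field,finite}, 'n::finite) mat2"
  assumes "character_on (+) UNIV \<psi>" "u \<in> unipotent K"
  shows "intertwine K (big_cell_fun K \<psi> chi T) (g ** u)
    = psi_T \<psi> T u * intertwine K (big_cell_fun K \<psi> chi T) g"
  by (simp add: intertwine_def matrix_mul_assoc big_cell_fun_right_translate[OF assms]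
      sum_distrib_left)

section \<open>The multiplier and the big cell\<close>

lemma similitude_multiplier_eq_1:
  fixes A B D :: "'a::field^'n::finite^'n"
  assumes "transpose D ** A = mat 1"
  shows "similitude_multiplier (block A B 0 D) = 1"
  unfolding similitude_multiplier_def
proof (rule the_equality)
  have DA: "A ** transpose D = mat 1"
    using assms matrix_left_right_inverse by blast
  then have "matrix_inv A = transpose D"
    by (rule matrix_inv_eqI)
  moreover have "invertible A"
    using assms DA by (auto simp: invertible_def)
  ultimately show "(1::'a) \<noteq> 0 \<and> (\<exists>A' B'. invertible A' \<and>
      block A B 0 D = block (mat_smult 1 A') B' 0 (transpose (matrix_inv A')))"
    by (intro conjI exI[of _ A] exI[of _ B]) auto
next
  fix l :: 'a
  assume "l \<noteq> 0 \<and> (\<exists>A' B'. invertible A' \<and>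
      block A B 0 D = block (mat_smult l A') B' 0 (transpose (matrix_inv A')))"
  then obtain A' where A': "invertible A'" "A = mat_smult l A'" "D = transpose (matrix_inv A')"
    by auto
  have "mat l = (mat 1 :: 'a^'n^'n)"
    using assms A' by (simp add: mat_smult_mult matrix_inv_inverse mat_eq_mat_smult[of l])
  then show "l = 1"
    by simp
qed

text \<open>
  In the groups of a form, \<open>unip X\<close> belongs to the group iff \<open>X\<^sup>t = - \<epsilon> X\<close>, a condition that passes to
  the inverse matrix. This makes \<open>X \<mapsto> \<epsilon> X\<^sup>-\<^sup>1\<close> an involution of the index set of the Gauss sum.
\<close>

lemma unip_eps_inverse_in_grp:
  fixes X Y :: "'a::{field,finite}^'n::finite^'n"
  assumes X: "unip X \<in> grp K" and XY: "X ** Y = mat 1"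
  shows "unip (mat_smult (eps K) Y) \<in> grp K"
proof (cases "K \<in> {GL, SL}")
  case True
  then show ?thesis by (simp add: unip_in_grp_iff)
next
  case False
  with X have X0: "X + mat_smult (eps K) (transpose X) = 0"
    by (simp add: unip_in_grp_iff)
  have YX: "Y ** X = mat 1"
    using XY matrix_left_right_inverse by blast
  have XtYt: "transpose X ** transpose Y = mat 1"
    by (metis YX matrix_transpose_mul transpose_mat)
  have "Y ** (X + mat_smult (eps K) (transpose X)) ** transpose Y
      = transpose Y + mat_smult (eps K) Y"
    by (simp add: matrix_add_ldistrib matrix_add_rdistrib mat_smult_mult YX)
      (simp add: XtYt flip: matrix_mul_assoc)
  then have "mat_smult (eps K) Y + mat_smult (eps K) (transpose (mat_smult (eps K) Y)) = 0"
    by (simp add: X0 transpose_mat_smult mat_smult_smult add.commute)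
  with False show ?thesis by (simp add: unip_in_grp_iff)
qed

lemma big_cellD:
  fixes p :: "('a::field, 'n::finite) mat2"
  assumes "p \<in> parabolic K" "u \<in> unipotent K" "block A B C D = p ** Jmat K ** u"
  shows "invertible C"
proof -
  obtain A' B' D' a d where p: "p = block A' B' 0 D'" "D' ** d = mat 1" "d ** D' = mat 1"
    using assms(1) by (rule parabolicD)
  obtain X where X: "u = unip X"
    using assms(2) by (rule unipotentE)
  have "C = D'"
    using assms(3) by (simp add: p(1) X unip_def Jmat_def block_mult)
  with p show ?thesis
    by (auto simp: invertible_def)
qed

text \<open>
  The \<open>U\<close>-part must have corner \<open>C\<^sup>-\<^sup>1 D\<close>. For the groups of a form, the symmetry of \<open>C\<^sup>-\<^sup>1 D\<close> that this
  requires is the isotropy of the bottom row \<open>(C, D)\<close>, multiplied by \<open>C\<^sup>-\<^sup>1\<close> and its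
  transpose from the two sides.
\<close>

lemma big_cellI:
  fixes A B C D :: "'a::{field,finite}^'n::finite^'n"
  assumes g: "block A B C D \<in> grp K" and C: "invertible C"
  shows "\<exists>p\<in>parabolic K. \<exists>u\<in>unipotent K. block A B C D = p ** Jmat K ** u"
proof -
  obtain Y where Y: "C ** Y = mat 1" "Y ** C = mat 1"
    using C by (auto simp: invertible_def)
  have CtYt: "transpose C ** transpose Y = mat 1"
    by (metis Y(2) matrix_transpose_mul transpose_mat)
  have uX: "unip (Y ** D) \<in> grp K"
  proof (cases "K \<in> {GL, SL}")
    case True
    then show ?thesis by (simp add: unip_in_grp_iff)
  next
    case False
    have "Y ** (C ** transpose D + mat_smult (eps K) (D ** transpose C)) ** transpose Y
        = transpose D ** transpose Y + mat_smult (eps K) (Y ** D)"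
      by (simp add: matrix_add_ldistrib matrix_add_rdistrib mat_smult_mult matrix_mul_assoc Y)
        (simp add: CtYt flip: matrix_mul_assoc)
    then have "mat_smult (eps K) (transpose D ** transpose Y + mat_smult (eps K) (Y ** D)) = 0"
      by (simp add: bottom_row_isotropic[OF g False])
    then have "Y ** D + mat_smult (eps K) (transpose (Y ** D)) = 0"
      by (simp add: matrix_transpose_mul mat_smult_add mat_smult_smult add.commute)
    with False show ?thesis by (simp add: unip_in_grp_iff)
  qed
  define p where "p = block A B C D ** unip (- (Y ** D)) ** Jinv K"
  have "p \<in> grp K"
    unfolding p_def using g uX by (intro grp_mult unip_uminus_in_grp Jinv_in_grp)
  moreover have "\<exists>A B D. p = block A B 0 D"
  proof -
    have "C ** (- (Y ** D)) + D = 0"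
      by (simp add: uminus_eq_mat_smult mat_smult_mult matrix_mul_assoc Y)
        (simp flip: uminus_eq_mat_smult)
    then show ?thesis
      by (simp add: p_def unip_def block_mult mat_mult_eq_mat_smult) 
  qed
  ultimately have "p \<in> parabolic K"
    by (simp add: parabolic_def)
  moreover have "block A B C D = p ** Jmat K ** unip (Y ** D)"
  proof -
    have "p ** Jmat K ** unip (Y ** D)
        = block A B C D ** (unip (- (Y ** D)) ** (Jinv K ** Jmat K) ** unip (Y ** D))"
      by (simp only: p_def matrix_mul_assoc)
    then show ?thesis by (simp add: matrix_inv_Jmat unip_mult unip_0)
  qed
  ultimately show ?thesis
    using uX unipotentI by blast
qed

section \<open>The value at \<open>J\<close>\<close>

lemma character_on_one:
  assumes "character_on (*) (- {0::'a::field}) \<beta>"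
  shows "\<beta> 1 = 1"
proof -
  have one: "(1::'a) \<in> - {0}"
    by simp
  then have "\<beta> (1 * 1) = \<beta> 1 * \<beta> 1" "\<beta> 1 \<noteq> 0"
    using assms unfolding character_on_def by blast+
  then show ?thesis by simp
qed

lemma opposite_unipotent_factorization:
  fixes X Y :: "'a::field^'n::finite^'n"
  assumes "X ** Y = mat 1"
  shows "Jinv K ** unip X ** Jmat K
    = block (- Y) (mat 1) 0 (mat_smult (eps K) X) ** Jmat K ** unip (mat_smult (eps K) Y)"
  by (simp add: Jmat_def unip_def block_mult mat_mult_eq_mat_smult mat_smult_mult mat_smult_smult
      assms uminus_eq_mat_smult mat_eq_mat_smult[of "eps K"] mult.commute)
    (simp add: mat_smult_def vec_eq_iff)

lemma intertwine_big_cell_fun_Jmat: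
  fixes chi :: "('a::{field,finite}, 'n::finite) mat2 \<Rightarrow> complex"
  assumes \<alpha>: "character_on (*) (- {0}) \<alpha>"
    and chi: "\<And>p. p \<in> parabolic K \<Longrightarrow> chi p = \<alpha> (multiplier K p) * \<beta> (chi_det p)"
  shows "intertwine K (big_cell_fun K \<psi> chi T) (Jmat K) = gauss_sum K \<beta> \<psi> T"
proof -
  let ?F = "big_cell_fun K \<psi> chi T"
  let ?inv = "\<lambda>X :: 'a^'n^'n. mat_smult (eps K) (matrix_inv X)"
  let ?S = "{X :: 'a^'n^'n. invertible X \<and> unip X \<in> grp K}"
  have opp: "Jinv K ** unip X ** Jmat K = block (mat 1) 0 (mat_smult (eps K) X) (mat 1)" for X :: "'a^'n^'n"
    by (simp add: Jmat_def unip_def block_mult mat_mult_eq_mat_smult mat_smult_smult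
        mat_eq_mat_smult[of "eps K"] mat_smult_mult)
  have at_J: "?F (Jinv K ** unip X ** Jmat K) = \<beta> (det (?inv X)) * \<psi> (trace (?inv X ** T))"
    if X: "X \<in> ?S" for X
  proof -
    define Y where "Y = matrix_inv X"
    have XY: "X ** Y = mat 1" "Y ** X = mat 1"
      using X by (simp_all add: Y_def matrix_inv_inverse)
    let ?e = "mat_smult (eps K)"
    let ?p = "block (- Y) (mat 1) 0 (?e X)"
    have uY: "unip (?e Y) \<in> grp K"
      using X XY by (auto intro: unip_eps_inverse_in_grp)
    have fact: "Jinv K ** unip X ** Jmat K = ?p ** Jmat K ** unip (?e Y)"
      using XY(1) by (rule opposite_unipotent_factorization)
    have "?p = ?p ** (Jmat K ** (unip (?e Y) ** unip (- ?e Y)) ** Jinv K)"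
      by (simp add: unip_mult unip_0 matrix_inv_Jmat)
    also have "\<dots> = Jinv K ** unip X ** Jmat K ** unip (- ?e Y) ** Jinv K"
      unfolding fact by (simp only: matrix_mul_assoc)
    also have "\<dots> \<in> grp K"
      using X uY by (intro grp_mult unip_uminus_in_grp Jinv_in_grp Jmat_in_grp) auto
    finally have p: "?p \<in> parabolic K"
      by (auto simp: parabolic_def)
    have "multiplier K ?p = 1"
    proof (cases "K = GL")
      case True
      then show ?thesis
        by (simp add: eps_def uminus_eq_mat_smult mat_smult_mult mat_smult_smult XY)
    next
      case False
      have "transpose (?e X) ** (- Y) = mat 1" if "K \<in> {GO, GSp}"
      proof -
        have "X + ?e (transpose X) = 0"
          using X that by (auto simp: unip_in_grp_iff)
        then have "?e (transpose X) = - X"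
          by (simp add: eq_neg_iff_add_eq_0 add.commute)
        then show ?thesis
          by (simp add: transpose_mat_smult uminus_eq_mat_smult mat_smult_mult mat_smult_smult XY)
      qed
      then have "similitude_multiplier ?p = 1" if "K \<in> {GO, GSp}"
        using that similitude_multiplier_eq_1 by blast
      with False show ?thesis
        by (cases K) auto
    qed
    moreover have "chi_det ?p = det (?e Y)"
    proof -
      have "?e X ** ?e Y = mat 1"
        by (simp add: mat_smult_mult mat_smult_smult XY)
      then have "det (?e X) * det (?e Y) = 1"
        by (metis det_I det_mul)
      then show ?thesis
        by (simp add: chi_det_def inverse_unique)
    qed
    ultimately have "chi ?p = \<beta> (det (?e Y))"
      using chi[OF p] character_on_one[OF \<alpha>] by simp
    then show ?thesis
      unfolding fact big_cell_fun_apply[OF p unipotentI[OF uY]]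
      by (simp add: psi_T_def unip_def Y_def)
  qed
  have zero: "?F (Jinv K ** unip X ** Jmat K) = 0" if "\<not> invertible X" for X
  proof -
    have "\<not> invertible (mat_smult (eps K) X)"
    proof
      assume "invertible (mat_smult (eps K) X)"
      then obtain Z where "mat_smult (eps K) X ** Z = mat 1" "Z ** mat_smult (eps K) X = mat 1"
        by (auto simp: invertible_def)
      then have "X ** mat_smult (eps K) Z = mat 1" "mat_smult (eps K) Z ** X = mat 1"
        by (simp_all add: mat_smult_mult)
      with that show False by (auto simp: invertible_def)
    qed
    then have "\<not> (\<exists>p\<in>parabolic K. \<exists>u\<in>unipotent K.
        block (mat 1) 0 (mat_smult (eps K) X) (mat 1) = p ** Jmat K ** u)"
      using big_cellD by blast
    then show ?thesis
      unfolding opp big_cell_fun_def by simp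
  qed
  have inv: "?inv X \<in> ?S" "?inv (?inv X) = X" if X: "X \<in> ?S" for X
  proof -
    have XY: "X ** matrix_inv X = mat 1" "matrix_inv X ** X = mat 1"
      using X by (simp_all add: matrix_inv_inverse)
    then have e: "mat_smult (eps K) X ** ?inv X = mat 1" "?inv X ** mat_smult (eps K) X = mat 1"
      by (simp_all add: mat_smult_mult mat_smult_smult)
    show "?inv X \<in> ?S"
      using X XY e unip_eps_inverse_in_grp by (auto simp: invertible_def)
    show "?inv (?inv X) = X"
      using matrix_inv_eqI[OF e(2)] by (simp add: mat_smult_smult)
  qed
  have "intertwine K ?F (Jmat K) = (\<Sum>X | unip X \<in> grp K. ?F (Jinv K ** unip X ** Jmat K))"
    unfolding intertwine_def matrix_inv_Jmat_eq
    by (rule sum.reindex_bij_witness[where i = unip and j = upper_right])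
      (auto simp: unipotent_def unip_def)
  also have "\<dots> = (\<Sum>X\<in>?S. ?F (Jinv K ** unip X ** Jmat K))"
    by (rule sum.mono_neutral_right) (simp, blast, use zero in blast)
  also have "\<dots> = (\<Sum>X\<in>?S. \<beta> (det (?inv X)) * \<psi> (trace (?inv X ** T)))"
    using at_J by (intro sum.cong) auto
  also have "\<dots> = gauss_sum K \<beta> \<psi> T"
    unfolding gauss_sum_def
    by (rule sum.reindex_bij_witness[where i = ?inv and j = ?inv]) (simp_all only: inv)
  finally show ?thesis .
qed

section \<open>Vanishing off the big cell\<close>

definition outer :: "'a::times^'n \<Rightarrow> 'a^'m \<Rightarrow> 'a^'m^'n" where
  "outer v w = (\<chi> i j. v $ i * w $ j)"

lemma matrix_mult_outer: "C ** outer v w = outer (C *v v) (w :: 'a::comm_semiring_1^'m)"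
  by (simp add: outer_def matrix_matrix_mult_def matrix_vector_mult_def vec_eq_iff
      sum_distrib_right mult.assoc)

lemma outer_zero [simp]: "outer 0 w = (0 :: 'a::semiring_1^'m^'n)"
  by (simp add: outer_def vec_eq_iff)

lemma trace_transpose: "trace (transpose A) = trace A"
  by (simp add: trace_def transpose_def)

lemma trace_outer_axis_mult:
  fixes T :: "'a::comm_semiring_1^'n^'n"
  shows "trace (outer v (axis j c) ** T) = c * (T *v v) $ j"
proof -
  have "trace (outer v (axis j c) ** T) = trace (T ** outer v (axis j c))"
    by (rule trace_mul_sym)
  also have "\<dots> = (\<Sum>i\<in>UNIV. if i = j then (T *v v) $ i * c else 0)"
    unfolding matrix_mult_outer trace_def by (intro sum.cong) (auto simp: outer_def axis_def)
  finally show ?thesis by (simp add: mult.commute)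
qed

text \<open>
  The condition \<open>C X c = 0\<close>, where \<open>c\<close> is the lower left block of the inverse of \<open>g\<close>, says that
  conjugation by \<open>g\<close> takes \<open>unip X\<close> into \<open>P\<close>. Requiring \<open>C X = 0\<close> instead would be too much for the
  groups of a form: if \<open>C\<close> has a kernel of dimension one on which \<open>v\<^sup>t T v\<close> vanishes, every admissible
  \<open>X\<close> with \<open>C X = 0\<close> satisfies \<open>tr X T = 0\<close>. There \<open>c\<close> is a multiple of \<open>C\<^sup>t\<close>, and
  \<open>X = v w\<^sup>t - \<epsilon> w v\<^sup>t\<close> with \<open>C v = 0\<close> satisfies the weaker condition.
\<close>

lemma exists_witness_matrix:
  fixes A B C D T :: "'a::{field,finite}^'n::finite^'n"
  assumes odd: "odd CARD('a)" and T: "invertible T" "unip T \<in> grp K"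
    and g: "block A B C D \<in> grp K" and h: "block A B C D ** block a b c d = mat 1"
    and C: "\<not> invertible C"
  obtains X where "unip X \<in> grp K" "C ** X ** c = 0" "trace (X ** T) = x"
proof -
  have "\<not> (\<exists>Y. Y ** C = mat 1)"
    using C matrix_left_right_inverse by (auto simp: invertible_def)
  then obtain v where v: "C *v v = 0" "v \<noteq> 0"
    using matrix_left_invertible_ker by blast
  obtain T' where "T' ** T = mat 1"
    using T(1) by (auto simp: invertible_def)
  then have "T *v v \<noteq> 0"
    using v(2) matrix_left_invertible_ker by blast
  then obtain j where j: "(T *v v) $ j \<noteq> 0"
    by (auto simp: vec_eq_iff)
  \<comment> \<open>\<open>R y\<close> is \<open>v w\<^sup>t\<close> with \<open>w\<close> scaled so that the trace against \<open>T\<close> is \<open>y\<close>.\<close>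
  define R where "R y = outer v (axis j (y / (T *v v) $ j))" for y
  have tr: "trace (R y ** T) = y" for y
    using j by (simp add: R_def trace_outer_axis_mult)
  have CR: "C ** R y = 0" for y
    by (simp add: R_def matrix_mult_outer v)
  show thesis
  proof (cases "K \<in> {GL, SL}")
    case True
    then show thesis
      by (intro that[of "R x"]) (simp_all add: unip_in_grp_iff CR tr)
  next
    case False
    let ?e = "mat_smult (eps K)"
    \<comment> \<open>By the symmetry of \<open>T\<close> the two summands have equal trace against \<open>T\<close>, hence \<open>x / 2\<close>.\<close>
    define X where "X = R (x / 2) + mat_smult (- eps K) (transpose (R (x / 2)))"
    have e: "M + mat_smult (- eps K) (transpose M) + ?e (transpose (M + mat_smult (- eps K) (transpose M))) = 0"
      for M :: "'a^'n^'n"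
      by (auto simp: mat_smult_def vec_eq_iff transpose_def eps_def)
    have "unip X \<in> grp K"
      using False unfolding unip_in_grp_iff X_def by (simp add: e)
    moreover have "C ** X ** c = 0"
    proof -
      obtain l where l: "l \<noteq> 0" "similitude K l (block A B C D)"
        using False g by (auto simp: grp_similitude_iff)
      let ?g = "block A B C D" and ?h = "block (transpose D) (?e (transpose B)) (?e (transpose C)) (transpose A)"
      have "block a b c d ** ?g = mat 1"
        using h matrix_left_right_inverse by blast
      then have "?h = block a b c d ** (?g ** ?h)"
        by (simp add: matrix_mul_assoc)
      also have "\<dots> = mat_smult l (block a b c d)"
        by (simp only: similitude_mult_adjoint[OF l(2,1)] mat_mult_eq_mat_smult)
      finally have "mat_smult (inverse l) (?e (transpose C)) = mat_smult (inverse l) (mat_smult l c)"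
        by (simp add: mat_smult_block)
      then have c: "c = mat_smult (inverse l * eps K) (transpose C)"
        using l(1) by (simp add: mat_smult_smult)
      have "transpose (R y) ** transpose C = 0" for y
        by (simp add: CR flip: matrix_transpose_mul)
      then have "C ** X ** transpose C = 0"
        by (simp add: X_def matrix_add_ldistrib matrix_add_rdistrib mat_smult_mult CR flip: matrix_mul_assoc)
      then show ?thesis
        by (simp add: c mat_smult_mult)
    qed
    moreover have "trace (X ** T) = x"
    proof -
      have "T + ?e (transpose T) = 0"
        using T(2) False by (simp add: unip_in_grp_iff)
      then have "?e (transpose T) = - T"
        by (simp add: eq_neg_iff_add_eq_0 add.commute)
      then have Tt: "mat_smult (- eps K) (transpose T) = T"
        by (simp add: mat_smult_def vec_eq_iff) 
      have "trace (mat_smult (- eps K) (transpose (R y)) ** T) = y" for y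
      proof -
        have "trace (mat_smult (- eps K) (transpose (R y)) ** T)
            = trace (transpose (mat_smult (- eps K) (transpose (R y)) ** T))"
          by (simp only: trace_transpose)
        also have "\<dots> = trace (mat_smult (- eps K) (transpose T) ** R y)"
          by (simp add: matrix_transpose_mul transpose_mat_smult mat_smult_mult)
        also have "\<dots> = trace (R y ** T)"
          unfolding Tt by (rule trace_mul_sym)
        finally show ?thesis by (simp add: tr)
      qed
      then have "trace (X ** T) = x / 2 + x / 2"
        by (simp add: X_def matrix_add_rdistrib trace_add tr)
      with two_neq_0[OF odd] show ?thesis by simp
    qed
    ultimately show thesis by (rule that)
  qed
qed

text \<open>
  Here \<open>g unip(X) g\<^sup>-\<^sup>1 = 1 + g N g\<^sup>-\<^sup>1\<close>, where \<open>N\<close> has \<open>X\<close> in its upper right corner.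
\<close>

lemma conj_unip:
  fixes A B C D :: "'a::field^'n::finite^'n"
  assumes "block A B C D ** block a b c d = mat 1" "C ** X ** c = 0"
  shows "block A B C D ** unip X ** block a b c d
    = block (mat 1 + A ** X ** c) (A ** X ** d) 0 (mat 1 + C ** X ** d)"
proof -
  have "block A B C D ** unip X ** block a b c d
      = block A B C D ** block a b c d + block A B C D ** block 0 X 0 0 ** block a b c d"
    by (simp add: unip_eq matrix_add_ldistrib matrix_add_rdistrib)
  also have "\<dots> = mat 1 + block (A ** X ** c) (A ** X ** d) 0 (C ** X ** d)"
    unfolding assms(1) by (simp add: assms(2) block_mult)
  finally show ?thesis
    by (simp add: mat_block block_add)
qed

text \<open>
  The trivial value of \<open>\<chi>\<^sup>J\<close> at \<open>p = g u g\<^sup>-\<^sup>1\<close> has two sources: the diagonal blocks of \<open>p\<close> have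
  determinant \<open>1\<close>, and the similitude factor of \<open>p\<close> is that of its conjugate \<open>u\<close>, which is \<open>1\<close>.
\<close>

lemma intertwine_vanishes_off_big_cell:
  fixes chi :: "('a::{field,finite}, 'n::finite) mat2 \<Rightarrow> complex"
  assumes odd: "odd CARD('a)" and T: "invertible T" "unip T \<in> grp K"
    and \<psi>: "character_on (+) UNIV \<psi>" "\<psi> x \<noteq> 1"
    and \<alpha>: "character_on (*) (- {0}) \<alpha>" and \<beta>: "character_on (*) (- {0}) \<beta>"
    and chi: "character_on (**) (parabolic K) chi"
      "\<And>p. p \<in> parabolic K \<Longrightarrow> chi p = \<alpha> (multiplier K p) * \<beta> (chi_det p)"
    and g: "block A B C D \<in> grp K" and C: "\<not> invertible C"
  shows "intertwine K (big_cell_fun K \<psi> chi T) (block A B C D) = 0"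
proof -
  let ?g = "block A B C D" and ?F = "big_cell_fun K \<psi> chi T"
  obtain h where h: "?g ** h = mat 1" "h ** ?g = mat 1"
    using grp_invertible[OF g] by (auto simp: invertible_def)
  obtain a b c d where h_eq: "h = block a b c d"
    by (rule block_cases)
  obtain X where X: "unip X \<in> grp K" "C ** X ** c = 0" "trace (X ** T) = x"
    using exists_witness_matrix[OF odd T g h(1)[unfolded h_eq] C] by blast
  define M N where "M = A ** X ** c" and "N = C ** X ** d"
  define p where "p = ?g ** unip X ** h"
  have p_eq: "p = block (mat 1 + M) (A ** X ** d) 0 (mat 1 + N)"
    unfolding p_def M_def N_def h_eq using h(1) X(2) unfolding h_eq by (rule conj_unip)
  have "p \<in> grp K"
    unfolding p_def using g X(1) grp_inverse[OF g h(1)] by (intro grp_mult)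
  then have p: "p \<in> parabolic K"
    by (auto simp: parabolic_def p_eq)
  have cAdC: "c ** A + d ** C = 0"
    using h(2) by (simp add: h_eq block_mult mat_block)
  \<comment> \<open>The lower left block of \<open>h ** g = 1\<close> vanishes; sandwiching it shows that \<open>M\<close> and \<open>N\<close> square to zero.\<close>
  have "A ** X ** (c ** A + d ** C) ** X ** c = M ** M + A ** X ** d ** (C ** X ** c)"
    by (simp add: M_def matrix_add_ldistrib matrix_add_rdistrib matrix_mul_assoc)
  then have "M ** M = 0"
    by (simp add: cAdC X(2))
  then have detM: "det (mat 1 + M) = 1"
    by (rule det_one_plus_square_zero)
  have "C ** X ** (c ** A + d ** C) ** X ** d = C ** X ** c ** (A ** X ** d) + N ** N"
    by (simp add: N_def matrix_add_ldistrib matrix_add_rdistrib matrix_mul_assoc)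
  then have "N ** N = 0"
    by (simp add: cAdC X(2))
  then have detN: "det (mat 1 + N) = 1"
    by (rule det_one_plus_square_zero)
  let ?q = "block (mat 1 + N) 0 0 (mat 1 + M)"
  have q: "?q \<in> parabolic K"
    using levi_in_grp(2)[of "mat 1 + M" "A ** X ** d" "mat 1 + N" K] p
    by (auto simp: p_eq parabolic_def)
  have "multiplier K ?q = 1"
  proof (cases "K \<in> {GO, GSp}")
    case True
    then have K: "K \<notin> {GL, SL}" by auto
    obtain l where l: "l \<noteq> 0" "similitude K l ?g"
      using g K by (auto simp: grp_similitude_iff)
    have u: "similitude K 1 (unip X)"
      using X(1) K by (simp add: unip_in_grp_iff) (simp add: unip_def similitude_upper_triangular_iff)
    have "similitude K (inverse l) h"
      using l h(1) similitude_inverse unfolding similitude_def by blast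
    then have "similitude K (l * 1 * inverse l) p"
      using l u unfolding similitude_def p_def by (intro similitude_mult)
    then have "similitude K 1 p"
      using l by simp
    then have "transpose (mat 1 + M) ** (mat 1 + N) = mat 1"
      unfolding p_eq similitude_upper_triangular_iff by blast
    then have "similitude_multiplier ?q = 1"
      by (rule similitude_multiplier_eq_1)
    with True show ?thesis by auto
  next
    case False
    then show ?thesis
      by (cases K) (auto simp: det_mul detM detN)
  qed
  then have one: "conj_char chi p = 1"
    using chi(2)[OF q] character_on_one[OF \<alpha>] character_on_one[OF \<beta>]
    by (simp add: conj_char_def p_eq chi_det_def detM)
  have "p ** ?g = ?g ** unip X"
    by (simp add: p_def h(2) flip: matrix_mul_assoc)
  then have "conj_char chi p * intertwine K ?F ?g = psi_T \<psi> T (unip X) * intertwine K ?F ?g"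
    using intertwine_induced[OF big_cell_fun_induced[OF chi(1)] p g]
      intertwine_big_cell_fun_right_translate[OF \<psi>(1) unipotentI[OF X(1)]]
    by metis
  moreover have "psi_T \<psi> T (unip X) = \<psi> x"
    by (simp add: psi_T_def unip_def X(3))
  ultimately show ?thesis
    using \<psi>(2) one by simp
qed

theorem proposition2p5p6:
  fixes K :: group_kind
    and \<psi> \<alpha> \<beta> :: "'a::{field,finite} \<Rightarrow> complex"
    and chi :: "('a, 'n::finite) mat2 \<Rightarrow> complex"
    and T :: "'a^'n^'n"
  assumes "odd CARD('a)" and "\<not> 3 dvd CARD('a)"
    and "invertible T" and "unip T \<in> grp K"
    and "character_on (+) UNIV \<psi>" and "\<exists>x. \<psi> x \<noteq> 1"
    and "character_on (*) (- {0}) \<alpha>" and "character_on (*) (- {0}) \<beta>"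
    and "character_on (**) (parabolic K) chi"
    and "\<forall>p\<in>parabolic K. chi p = \<alpha> (multiplier K p) * \<beta> (chi_det p)"
  shows "\<forall>g\<in>grp K. intertwine K (big_cell_fun K \<psi> chi T) g
           = gauss_sum K \<beta> \<psi> T * big_cell_fun K \<psi> (conj_char chi) T g"
proof
  fix g :: "('a, 'n) mat2"
  assume g: "g \<in> grp K"
  let ?F = "big_cell_fun K \<psi> chi T"
  show "intertwine K ?F g = gauss_sum K \<beta> \<psi> T * big_cell_fun K \<psi> (conj_char chi) T g"
  proof (cases "\<exists>p\<in>parabolic K. \<exists>u\<in>unipotent K. g = p ** Jmat K ** u")
    case True
    then obtain p u where pu: "p \<in> parabolic K" "u \<in> unipotent K" "g = p ** Jmat K ** u"
      by blast
    have "intertwine K ?F g = psi_T \<psi> T u * (conj_char chi p * intertwine K ?F (Jmat K))"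
      by (simp add: pu intertwine_big_cell_fun_right_translate[OF assms(5)]
          intertwine_induced[OF big_cell_fun_induced[OF assms(9)]] Jmat_in_grp)
    also have "intertwine K ?F (Jmat K) = gauss_sum K \<beta> \<psi> T"
      using assms(7,10) by (intro intertwine_big_cell_fun_Jmat) auto
    finally show ?thesis
      by (simp add: pu big_cell_fun_apply)
  next
    case False
    obtain A B C D where g_eq: "g = block A B C D"
      by (rule block_cases)
    have "\<not> invertible C"
      using False g big_cellI unfolding g_eq by blast
    moreover obtain x where "\<psi> x \<noteq> 1"
      using assms(6) by blast
    ultimately have "intertwine K ?F g = 0"
      using assms g unfolding g_eq by (intro intertwine_vanishes_off_big_cell) auto
    moreover have "big_cell_fun K \<psi> (conj_char chi) T g = 0"
      using False by (simp add: big_cell_fun_def)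
    ultimately show ?thesis by simp
  qed
qed

end
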